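(* For all integers $i,j$ with $1 \le i < j \le m+1$, $$A_i B_j = A_j B_i .$$
   Context: Let $m\ge 1$ be an integer and let $d_1,\dots,d_{m+1}$ and $n_1,\dots,n_{m+1}$ be nonzero real numbers. Define $m\times m$ real triangular Toeplitz matrices as follows. $D_L$ is lower triangular with $(p,q)$ entry $d_{p-q+1}$ if $p\ge q$ and $0$ if $p<q$ (so $d_1$ is on the diagonal and the first column is $(d_1,\dots,d_m)^T$). $D_U$ is upper triangular with $(p,q)$ entry $d_{m+1-(q-p)}$ if $q\ge p$ and $0$ if $q<p$ (so $d_{m+1}$ is on the diagonal and the first row is $(d_{m+1},d_m,\dots,d_2)$). $N_L$ and $N_U$ are defined in the same way with $n_k$ in place of $d_k$. Define the $2m\times 2m$ block matrices $$S=\begin{pmatrix} D_L & N_L\\ D_U & N_U\end{pmatrix},\qquad D=\begin{pmatrix} D_L & 0\\ D_U & D_L\end{pmatrix}.$$ The numbers $d_k,n_k$ are assumed to be such that both $S$ and $D$ are invertible. Put $A=D^{-1}$ and $B=S^{-1}$. Let $A_B$ (respectively $B_B$) be the $m\times 2m$ matrix consisting of the last $m$ rows of $A$ (respectively $B$). For $1\le i\le m+1$, $A_i$ (respectively $B_i$) denotes the $m\times m$ submatrix of $A_B$ (respectively $B_B$) consisting of its $m$ consecutive columns $i,i+1,\dots,i+m-1$. *)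

theory Defs
  imports "Jordan_Normal_Form.Matrix"
begin

text \<open>
  Matrix entries are indexed from 0 in the library, whereas the parameters \<open>d k\<close>, \<open>n k\<close>
  (\<open>1 \<le> k \<le> m + 1\<close>) keep their indexing from 1; values outside this range are never used.
  The entry formulas below depend only on differences of indices, so they are unaffected by the shift.
\<close>

definition lower_toeplitz :: "nat \<Rightarrow> (nat \<Rightarrow> real) \<Rightarrow> real mat" where
  "lower_toeplitz m c = mat m m (\<lambda>(p, q). if q \<le> p then c (p - q + 1) else 0)"

definition upper_toeplitz :: "nat \<Rightarrow> (nat \<Rightarrow> real) \<Rightarrow> real mat" where
  "upper_toeplitz m c = mat m m (\<lambda>(p, q). if p \<le> q then c (m + 1 - (q - p)) else 0)"

definition S_mat :: "nat \<Rightarrow> (nat \<Rightarrow> real) \<Rightarrow> (nat \<Rightarrow> real) \<Rightarrow> real mat" where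
  "S_mat m d n = four_block_mat (lower_toeplitz m d) (lower_toeplitz m n)
                                (upper_toeplitz m d) (upper_toeplitz m n)"

definition D_mat :: "nat \<Rightarrow> (nat \<Rightarrow> real) \<Rightarrow> real mat" where
  "D_mat m d = four_block_mat (lower_toeplitz m d) (0\<^sub>m m m)
                              (upper_toeplitz m d) (lower_toeplitz m d)"

definition bottom_rows :: "nat \<Rightarrow> real mat \<Rightarrow> real mat" where
  "bottom_rows m X = mat m (2 * m) (\<lambda>(p, q). X $$ (m + p, q))"

text \<open>
  For a \<open>2m \<times> 2m\<close> matrix \<open>X\<close> and \<open>1 \<le> i \<le> m + 1\<close>: the columns \<open>i, \<dots>, i + m - 1\<close>,
  counted from 1, of the last \<open>m\<close> rows of \<open>X\<close>.
\<close>

definition bottom_window :: "nat \<Rightarrow> real mat \<Rightarrow> nat \<Rightarrow> real mat" where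
  "bottom_window m X i = mat m m (\<lambda>(p, q). bottom_rows m X $$ (p, i - 1 + q))"

end

theory Submission
  imports Defs "HOL-Computational_Algebra.Polynomial"
begin

text \<open>
  Read \<open>d\<close> and \<open>n\<close> as polynomials of degree \<open>m\<close>. Then \<open>S\<close> is their Sylvester matrix: the column
  \<open>c\<close> of \<open>B = S\<inverse>\<close> holds the coefficients of the polynomials \<open>P\<close>, \<open>Q\<close> of degree less than \<open>m\<close> with
  \<open>d P + n Q = x\<^sup>c\<close>. Multiplying by \<open>x\<close> and reducing \<open>x Q\<close> modulo \<open>d\<close> yields the column \<open>c + 1\<close>.
  Hence the lower half of column \<open>c + 1\<close> is the shifted lower half of column \<open>c\<close> minus a multiple
  of the coefficients of \<open>d\<close>, and the latter are annihilated by the rows of \<open>A\<close> because \<open>A D = 1\<close>.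
  So the entries of \<open>A\<^sub>i B\<^sub>j\<close> do not change when \<open>(i + 1, j)\<close> is replaced by \<open>(i, j + 1)\<close>: they
  depend on \<open>i + j\<close> only.
\<close>

definition poly_upto :: "nat \<Rightarrow> (nat \<Rightarrow> 'a) \<Rightarrow> 'a::comm_monoid_add poly" where
  "poly_upto k f = (\<Sum>i<k. monom (f i) i)"

lemma coeff_poly_upto: "coeff (poly_upto k f) i = (if i < k then f i else 0)"
  by (simp add: poly_upto_def coeff_sum if_distrib cong: if_cong)

text \<open>The unknowns of the Sylvester system, stacked so that \<open>P\<close> meets the columns
  built from \<open>d\<close> and \<open>Q\<close> those built from \<open>n\<close>.\<close>

definition coeff_vec :: "nat \<Rightarrow> real poly \<Rightarrow> real poly \<Rightarrow> real vec" where
  "coeff_vec m P Q = vec (2 * m) (\<lambda>c. if c < m then coeff P c else coeff Q (c - m))"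

lemma coeff_vec_carrier: "coeff_vec m P Q \<in> carrier_vec (2 * m)"
  by (simp add: coeff_vec_def)

lemma S_mat_carrier: "S_mat m d n \<in> carrier_mat (2 * m) (2 * m)"
  unfolding mult_2 by (simp add: S_mat_def lower_toeplitz_def upper_toeplitz_def)

lemma D_mat_carrier: "D_mat m d \<in> carrier_mat (2 * m) (2 * m)"
  unfolding mult_2 by (simp add: D_mat_def lower_toeplitz_def)

text \<open>The two triangular blocks glue into a single band: in row \<open>r = m + p\<close> the
  index \<open>m + 1 - (c - p)\<close> of the upper triangular block is again
  \<open>r - c + 1\<close>.\<close>

lemma S_mat_left:
  assumes "r < 2 * m" "c < m"
  shows "S_mat m d n $$ (r, c) = (if c \<le> r \<and> r \<le> c + m then d (r - c + 1) else 0)"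
  using assms by (auto simp: S_mat_def lower_toeplitz_def upper_toeplitz_def intro!: arg_cong[where f=d])

lemma S_mat_right:
  assumes "r < 2 * m" "c < m"
  shows "S_mat m d n $$ (r, m + c) = (if c \<le> r \<and> r \<le> c + m then n (r - c + 1) else 0)"
  using assms by (auto simp: S_mat_def lower_toeplitz_def upper_toeplitz_def intro!: arg_cong[where f=n])

lemma D_mat_left:
  assumes "r < 2 * m" "c < m"
  shows "D_mat m d $$ (r, c) = (if c \<le> r \<and> r \<le> c + m then d (r - c + 1) else 0)"
  using assms by (auto simp: D_mat_def lower_toeplitz_def upper_toeplitz_def intro!: arg_cong[where f=d])

lemma sum_upto_double:
  fixes f :: "nat \<Rightarrow> 'a::comm_monoid_add"
  shows "(\<Sum>c<2 * m. f c) = (\<Sum>c<m. f c) + (\<Sum>c<m. f (m + c))"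
proof -
  have "(\<Sum>c\<in>{0..<2 * m}. f c) = (\<Sum>c\<in>{0..<m}. f c) + (\<Sum>c\<in>{m..<2 * m}. f c)"
    by (simp add: sum.atLeastLessThan_concat)
  also have "(\<Sum>c\<in>{m..<2 * m}. f c) = (\<Sum>c\<in>{0..<m}. f (m + c))"
    using sum.shift_bounds_nat_ivl[of f 0 m m] by (simp add: mult_2 add.commute)
  finally show ?thesis by (simp add: atLeast0LessThan)
qed

text \<open>A banded Toeplitz matrix acts as a convolution. The band cuts off the columns beyond
  \<open>r\<close>, and the degree bound on \<open>P\<close> removes the terms of the convolution
  from \<open>m\<close> on.\<close>

lemma banded_toeplitz_sum:
  fixes f :: "nat \<Rightarrow> real"
  assumes "\<And>i. m \<le> i \<Longrightarrow> coeff P i = 0"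
  shows "(\<Sum>c<m. (if c \<le> r \<and> r \<le> c + m then f (r - c + 1) else 0) * coeff P c)
    = coeff (poly_upto (m + 1) (\<lambda>k. f (k + 1)) * P) r"
proof -
  have "coeff (P * poly_upto (m + 1) (\<lambda>k. f (k + 1))) r
      = (\<Sum>c\<le>r. coeff P c * (if r - c < m + 1 then f (r - c + 1) else 0))"
    by (simp add: coeff_mult coeff_poly_upto cong: if_cong)
  also have "\<dots> = (\<Sum>c<m. (if c \<le> r \<and> r \<le> c + m then f (r - c + 1) else 0) * coeff P c)"
    by (intro sum.mono_neutral_cong) (use assms in \<open>auto simp: not_less\<close>)
  finally show ?thesis by (simp add: mult.commute)
qed

lemma S_mat_mult_coeff_vec:
  assumes "\<And>i. m \<le> i \<Longrightarrow> coeff P i = 0" "\<And>i. m \<le> i \<Longrightarrow> coeff Q i = 0"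
  shows "S_mat m d n *\<^sub>v coeff_vec m P Q = vec (2 * m) (coeff
    (poly_upto (m + 1) (\<lambda>k. d (k + 1)) * P + poly_upto (m + 1) (\<lambda>k. n (k + 1)) * Q))"
    (is "_ = vec _ (coeff ?R)")
proof (rule eq_vecI)
  fix r assume "r < dim_vec (vec (2 * m) (coeff ?R))"
  then have r: "r < 2 * m" by simp
  have "(S_mat m d n *\<^sub>v coeff_vec m P Q) $ r
      = (\<Sum>c<2 * m. S_mat m d n $$ (r, c) * (coeff_vec m P Q $ c))"
    using r S_mat_carrier[of m d n]
    by (auto simp: scalar_prod_def atLeast0LessThan coeff_vec_def intro!: sum.cong)
  also have "\<dots> = coeff ?R r"
    by (simp add: sum_upto_double coeff_vec_def S_mat_left S_mat_right r
        banded_toeplitz_sum[OF assms(1), where f = d] banded_toeplitz_sum[OF assms(2), where f = n])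
  finally show "(S_mat m d n *\<^sub>v coeff_vec m P Q) $ r = vec (2 * m) (coeff ?R) $ r"
    using r by simp
qed (use S_mat_carrier[of m d n] in simp)

lemma S_inverse_column_shift:
  assumes "m \<ge> 1" and "d (m + 1) \<noteq> 0"
    and B: "B \<in> carrier_mat (2 * m) (2 * m)"
    and SB: "inverts_mat (S_mat m d n) B" and BS: "inverts_mat B (S_mat m d n)"
    and c: "c + 1 < 2 * m"
  obtains \<kappa> where "B $$ (2 * m - 1, c) = \<kappa> * d (m + 1)"
    and "\<And>l. l < m \<Longrightarrow> B $$ (m + l, c + 1) = (if l = 0 then 0 else B $$ (m + l - 1, c)) - \<kappa> * d (l + 1)"
proof -
  define dp np where "dp = poly_upto (m + 1) (\<lambda>k. d (k + 1))"
    and "np = poly_upto (m + 1) (\<lambda>k. n (k + 1))"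
  define P Q where "P = poly_upto m (\<lambda>l. B $$ (l, c))" and "Q = poly_upto m (\<lambda>l. B $$ (m + l, c))"
  \<comment> \<open>The quotient of \<open>x * Q\<close> by \<open>dp\<close>: this choice cancels
    the coefficient of degree \<open>m\<close> in \<open>Q'\<close>. The compensating term in
    \<open>P'\<close> makes the multiples of \<open>dp * np\<close> cancel in
    \<open>dp * P' + np * Q'\<close>.\<close>
  define \<kappa> where "\<kappa> = coeff Q (m - 1) / d (m + 1)"
  define P' Q' where "P' = pCons 0 P + smult \<kappa> np" and "Q' = pCons 0 Q - smult \<kappa> dp"
  have S: "S_mat m d n \<in> carrier_mat (2 * m) (2 * m)" by (rule S_mat_carrier)
  have SB1: "S_mat m d n * B = 1\<^sub>m (2 * m)" and BS1: "B * S_mat m d n = 1\<^sub>m (2 * m)"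
    using SB BS B S by (simp_all add: inverts_mat_def)
  have zero: "coeff P i = 0" "coeff Q i = 0" if "m \<le> i" for i
    using that by (simp_all add: P_def Q_def coeff_poly_upto)
  have "col B c = coeff_vec m P Q"
    using B c by (intro eq_vecI) (auto simp: coeff_vec_def P_def Q_def coeff_poly_upto)
  then have "vec (2 * m) (coeff (dp * P + np * Q)) = S_mat m d n *\<^sub>v col B c"
    by (simp add: S_mat_mult_coeff_vec zero dp_def np_def)
  also have "\<dots> = col (S_mat m d n * B) c"
    using S B c by (simp add: col_mult2)
  also have "\<dots> = unit_vec (2 * m) c"
    using c by (simp add: SB1)
  finally have vec_eq: "vec (2 * m) (coeff (dp * P + np * Q)) = unit_vec (2 * m) c" .
  have R: "coeff (dp * P + np * Q) r = (if r = c then 1 else 0)" if "r < 2 * m" for r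
  proof -
    have "coeff (dp * P + np * Q) r = vec (2 * m) (coeff (dp * P + np * Q)) $ r"
      using that by (rule index_vec[symmetric])
    also have "\<dots> = unit_vec (2 * m) c $ r" by (simp only: vec_eq)
    finally show ?thesis using that c by simp
  qed
  \<comment> \<open>Only the product of the two leading terms reaches degree
    \<open>2 * m - 1\<close>.\<close>
  have top: "coeff (poly_upto (m + 1) f * p) (2 * m - 1) = f m * coeff p (m - 1)"
    if "\<And>i. m \<le> i \<Longrightarrow> coeff p i = 0" for f :: "nat \<Rightarrow> real" and p
  proof -
    have "coeff (poly_upto (m + 1) f * p) (2 * m - 1)
        = (\<Sum>i\<le>2 * m - 1. if i = m then f m * coeff p (m - 1) else 0)"
      unfolding coeff_mult
    proof (intro sum.cong refl)
      fix i assume "i \<in> {..2 * m - 1}"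
      moreover have "2 * m - 1 - m = m - 1" by simp
      ultimately show "coeff (poly_upto (m + 1) f) i * coeff p (2 * m - 1 - i)
          = (if i = m then f m * coeff p (m - 1) else 0)"
        using that[of "2 * m - 1 - i"] by (cases i m rule: linorder_cases) (auto simp: coeff_poly_upto)
    qed
    also have "\<dots> = f m * coeff p (m - 1)" using \<open>m \<ge> 1\<close> by simp
    finally show ?thesis .
  qed
  \<comment> \<open>Since \<open>c < 2 * m - 1\<close>, the leading terms of \<open>dp * P\<close>
    and \<open>np * Q\<close> cancel. Hence the same \<kappa> also removes the coefficient of degree
    \<open>m\<close> from \<open>P'\<close>.\<close>
  have "coeff (dp * P + np * Q) (2 * m - 1) = 0"
    using R[of "2 * m - 1"] c by simp
  then have "d (m + 1) * coeff P (m - 1) + n (m + 1) * coeff Q (m - 1) = 0"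
    by (simp add: dp_def np_def top zero del: add_2_eq_Suc' One_nat_def)
  then have PQ: "coeff P (m - 1) + \<kappa> * n (m + 1) = 0"
    using assms(2) by (simp add: \<kappa>_def field_simps)
  have zero': "coeff P' i = 0" "coeff Q' i = 0" if "m \<le> i" for i
  proof -
    define k where "k = i - 1"
    then have k: "i = Suc k" "m - 1 \<le> k"
      using \<open>m \<ge> 1\<close> that by auto
    have "coeff P' i = 0 \<and> coeff Q' i = 0"
    proof (cases "k = m - 1")
      case True
      then have "k < m" "m = Suc k" using \<open>m \<ge> 1\<close> by auto
      with k PQ assms(2) show ?thesis
        by (simp add: P'_def Q'_def dp_def np_def coeff_poly_upto \<kappa>_def)
    next
      case False
      then have "m \<le> k" using k by simp
      with k show ?thesis
        by (simp add: P'_def Q'_def dp_def np_def coeff_poly_upto zero)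
    qed
    then show "coeff P' i = 0" "coeff Q' i = 0" by auto
  qed
  have "dp * P' + np * Q' = pCons 0 (dp * P + np * Q)"
    by (simp add: P'_def Q'_def algebra_simps)
  then have "S_mat m d n *\<^sub>v coeff_vec m P' Q' = vec (2 * m) (coeff (pCons 0 (dp * P + np * Q)))"
    by (simp only: S_mat_mult_coeff_vec[OF zero'] dp_def np_def)
  also have "\<dots> = unit_vec (2 * m) (c + 1)"
    by (rule eq_vecI) (use c in \<open>auto simp: R coeff_pCons simp del: coeff_add split: nat.split\<close>)
  finally have "S_mat m d n *\<^sub>v coeff_vec m P' Q' = unit_vec (2 * m) (c + 1)" .
  \<comment> \<open>The left inverse gives uniqueness: the pair \<open>P'\<close>,
    \<open>Q'\<close>, which solves the system for \<open>x^(c + 1)\<close>, must be column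
    \<open>c + 1\<close> of \<open>B\<close>.\<close>
  then have "B *\<^sub>v unit_vec (2 * m) (c + 1) = (B * S_mat m d n) *\<^sub>v coeff_vec m P' Q'"
    using B S by (simp add: assoc_mult_mat_vec[OF _ _ coeff_vec_carrier])
  also have "\<dots> = coeff_vec m P' Q'"
    using coeff_vec_carrier by (simp add: BS1)
  finally have "B *\<^sub>v unit_vec (2 * m) (c + 1) = coeff_vec m P' Q'" .
  moreover have "B *\<^sub>v unit_vec (2 * m) (c + 1) = col B (c + 1)"
    by (rule eq_vecI) (use B c in auto)
  ultimately have col: "col B (c + 1) = coeff_vec m P' Q'" by simp
  show thesis
  proof (rule that[of \<kappa>])
    have "m + (m - 1) = 2 * m - 1" by simp
    then show "B $$ (2 * m - 1, c) = \<kappa> * d (m + 1)"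
      using assms(1,2) by (simp add: \<kappa>_def Q_def coeff_poly_upto)
  next
    fix l assume l: "l < m"
    have "B $$ (m + l, c + 1) = col B (c + 1) $ (m + l)"
      using B c l by simp
    also have "\<dots> = coeff Q' l"
      unfolding col using l by (simp add: coeff_vec_def)
    also have "\<dots> = (if l = 0 then 0 else B $$ (m + l - 1, c)) - \<kappa> * d (l + 1)"
      using l by (auto simp: Q'_def Q_def dp_def coeff_pCons coeff_poly_upto split: nat.split)
    finally show "B $$ (m + l, c + 1) = (if l = 0 then 0 else B $$ (m + l - 1, c)) - \<kappa> * d (l + 1)" .
  qed
qed

text \<open>Column \<open>s\<close> of \<open>D_mat m d\<close> carries the whole sequence
  \<open>d 1\<close>, ..., \<open>d (m + 1)\<close> in rows \<open>s\<close> to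
  \<open>s + m\<close>. The sum is therefore the entry \<open>(m + p, s)\<close> of the identity
  matrix, off the diagonal because \<open>s < m\<close>.\<close>

lemma D_inverse_row_annihilates:
  assumes A: "A \<in> carrier_mat (2 * m) (2 * m)" and AD: "inverts_mat A (D_mat m d)"
    and "p < m" "s < m"
  shows "(\<Sum>l\<le>m. A $$ (m + p, s + l) * d (l + 1)) = 0"
proof -
  have D: "D_mat m d \<in> carrier_mat (2 * m) (2 * m)" by (rule D_mat_carrier)
  have "(\<Sum>l\<le>m. A $$ (m + p, s + l) * d (l + 1))
      = (\<Sum>r\<in>{s..m + s}. A $$ (m + p, r) * d (r - s + 1))"
    by (rule sum.reindex_bij_witness[of _ "\<lambda>r. r - s" "\<lambda>l. s + l"]) auto
  also have "\<dots> = (\<Sum>r\<in>{0..<2 * m}. A $$ (m + p, r) * D_mat m d $$ (r, s))"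
    by (rule sum.mono_neutral_cong_left) (use assms in \<open>auto simp: D_mat_left\<close>)
  also have "\<dots> = (A * D_mat m d) $$ (m + p, s)"
    using A D assms by (auto simp: scalar_prod_def intro!: sum.cong)
  also have "A * D_mat m d = 1\<^sub>m (2 * m)"
    using AD A by (simp add: inverts_mat_def)
  finally show ?thesis using assms by simp
qed

lemma window_sum_shift:
  assumes "m \<ge> 1" and "d (m + 1) \<noteq> 0"
    and A: "A \<in> carrier_mat (2 * m) (2 * m)" and AD: "inverts_mat A (D_mat m d)"
    and B: "B \<in> carrier_mat (2 * m) (2 * m)"
    and SB: "inverts_mat (S_mat m d n) B" and BS: "inverts_mat B (S_mat m d n)"
    and "p < m" "s < m" and c: "c + 1 < 2 * m"
  shows "(\<Sum>l<m. A $$ (m + p, Suc s + l) * B $$ (m + l, c))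
       = (\<Sum>l<m. A $$ (m + p, s + l) * B $$ (m + l, Suc c))"
proof -
  from S_inverse_column_shift[OF assms(1,2) B SB BS c] obtain \<kappa>
    where top: "B $$ (2 * m - 1, c) = \<kappa> * d (m + 1)"
      and step: "\<And>l. l < m \<Longrightarrow> B $$ (m + l, c + 1) = (if l = 0 then 0 else B $$ (m + l - 1, c)) - \<kappa> * d (l + 1)"
    by blast
  define x where "x l = (if l = 0 then 0 else B $$ (m + l - 1, c))" for l
  have xm: "x m = \<kappa> * d (m + 1)"
    using top \<open>m \<ge> 1\<close> by (simp add: x_def mult_2)
  have "(\<Sum>l<m. A $$ (m + p, s + l) * B $$ (m + l, Suc c))
      = (\<Sum>l<m. A $$ (m + p, s + l) * (x l - \<kappa> * d (l + 1)))"
    by (rule sum.cong) (use step in \<open>auto simp: x_def\<close>)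
  \<comment> \<open>The added term \<open>l = m\<close> is zero by the value of \<open>x m\<close>.
    The range now has the \<open>m + 1\<close> terms needed for the row of \<open>A\<close> to
    annihilate \<open>d\<close>.\<close>
  also have "\<dots> = (\<Sum>l<Suc m. A $$ (m + p, s + l) * (x l - \<kappa> * d (l + 1)))"
    by (simp add: xm)
  also have "\<dots> = (\<Sum>l<Suc m. A $$ (m + p, s + l) * x l)
      - \<kappa> * (\<Sum>l<Suc m. A $$ (m + p, s + l) * d (l + 1))"
    unfolding sum_distrib_left sum_subtractf[symmetric]
    by (rule sum.cong) (auto simp: algebra_simps)
  also have "(\<Sum>l<Suc m. A $$ (m + p, s + l) * d (l + 1)) = 0"
    using D_inverse_row_annihilates[OF A AD \<open>p < m\<close> \<open>s < m\<close>] by (simp only: lessThan_Suc_atMost)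
  \<comment> \<open>As \<open>x 0 = 0\<close>, the sum starts at \<open>l = 1\<close>; reindexing
    moves the shift from \<open>B\<close> to the window of \<open>A\<close>.\<close>
  also have "(\<Sum>l<Suc m. A $$ (m + p, s + l) * x l)
      = (\<Sum>l<m. A $$ (m + p, Suc s + l) * B $$ (m + l, c))"
    by (subst sum.lessThan_Suc_shift) (simp add: x_def)
  finally show ?thesis by simp
qed

lemma bottom_window_mult_index:
  assumes "1 \<le> i" "i \<le> m + 1" "1 \<le> j" "j \<le> m + 1" "p < m" "q < m"
  shows "(bottom_window m A i * bottom_window m B j) $$ (p, q)
       = (\<Sum>l<m. A $$ (m + p, i - 1 + l) * B $$ (m + l, j - 1 + q))"
  using assms
  by (auto simp: bottom_window_def bottom_rows_def scalar_prod_def atLeast0LessThan intro!: sum.cong)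

theorem theorem1p1:
  fixes m :: nat and d n :: "nat \<Rightarrow> real" and A B :: "real mat" and i j :: nat
  assumes "m \<ge> 1"
    and "\<And>k. 1 \<le> k \<Longrightarrow> k \<le> m + 1 \<Longrightarrow> d k \<noteq> 0"
    and "\<And>k. 1 \<le> k \<Longrightarrow> k \<le> m + 1 \<Longrightarrow> n k \<noteq> 0"
    and "invertible_mat (S_mat m d n)"
    and "invertible_mat (D_mat m d)"
    and "A \<in> carrier_mat (2 * m) (2 * m)"
    and "inverts_mat (D_mat m d) A" and "inverts_mat A (D_mat m d)"
    and "B \<in> carrier_mat (2 * m) (2 * m)"
    and "inverts_mat (S_mat m d n) B" and "inverts_mat B (S_mat m d n)"
    and "1 \<le> i" and "i < j" and "j \<le> m + 1"
  shows "bottom_window m A i * bottom_window m B j = bottom_window m A j * bottom_window m B i"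
proof (rule eq_matI)
  fix p q
  assume "p < dim_row (bottom_window m A j * bottom_window m B i)"
    and "q < dim_col (bottom_window m A j * bottom_window m B i)"
  then have p: "p < m" and q: "q < m" by (simp_all add: bottom_window_def)
  define F where "F s t = (\<Sum>l<m. A $$ (m + p, s + l) * B $$ (m + l, t + q))" for s t
  \<comment> \<open>From \<open>t < m\<close> and \<open>q < m\<close> follows
    \<open>t + q + 1 < 2 * m\<close>, so column \<open>t + q\<close> of \<open>B\<close> has a
    successor.\<close>
  have shift: "F (Suc s) t = F s (Suc t)" if "s < m" "t < m" for s t
    using window_sum_shift[of m d A B n p s "t + q"] assms p q that by (simp add: F_def)
  \<comment> \<open>The excess \<open>k\<close> passes from the first argument to the second one
    unit at a time. Before each unit moves, the second argument is below \<open>m\<close>, and so is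
    the first after its decrease, as \<open>shift\<close> requires.\<close>
  have moved: "F (s + k) s = F s (s + k)" if "s + k \<le> m" for s k
  proof -
    have "F (s + k) s = F (s + k - e) (s + e)" if "e \<le> k" for e
      using that
    proof (induction e)
      case (Suc e)
      then have "F (s + k) s = F (Suc (s + k - Suc e)) (s + e)"
        by (simp add: Suc_diff_Suc)
      also have "\<dots> = F (s + k - Suc e) (s + Suc e)"
        using shift[of "s + k - Suc e" "s + e"] Suc.prems \<open>s + k \<le> m\<close> by simp
      finally show ?case .
    qed simp
    from this[of k] show ?thesis by simp
  qed
  have "(i - 1) + (j - i) = j - 1" using assms by simp
  then have "F (j - 1) (i - 1) = F (i - 1) (j - 1)"
    using moved[of "i - 1" "j - i"] assms by simp
  then show "(bottom_window m A i * bottom_window m B j) $$ (p, q)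
      = (bottom_window m A j * bottom_window m B i) $$ (p, q)"
    using assms p q by (simp add: bottom_window_mult_index F_def)
qed (simp_all add: bottom_window_def)

end
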